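(* (R\'enyi-Quantum Star Test.) Let $n\ge 2$ and let $G$ be a graph on $n$ vertices with at least one edge, with vertex degrees $d_1,\dots,d_n$ and degree sum $d_G=\sum_i d_i$. If \[\frac{d_G^2}{\sum_{i=1}^n d_i^2+d_G}\geq \frac{2n-2}{n^{\frac{n}{2n-2}}},\] then $S(G)\geq H_2(G)\geq S(K_{1,n-1})$.
   Context: For a graph $G$ with at least one edge, let $L(G)=D(G)-A(G)$ be its combinatorial Laplacian and $\rho(G)=\frac{1}{\operatorname{tr}L(G)}L(G)$, with eigenvalues $\lambda_1,\dots,\lambda_n$ (with multiplicity). The von Neumann entropy is $S(G)=-\sum_i\lambda_i\log_2\lambda_i$ (with $0\log_2 0:=0$). For $\alpha\ge 0$, $\alpha\ne 1$, the R\'enyi $\alpha$-entropy of $G$ is $H_\alpha(G)=\frac{1}{1-\alpha}\log_2\big(\sum_i\lambda_i^\alpha\big)$; in particular $H_2(G)=-\log_2\sum_i\lambda_i^2$. $K_{1,n-1}$ is the star on $n$ vertices. *)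

theory Defs
  imports
    "Graph_Theory.Graph_Theory"
    "Jordan_Normal_Form.Char_Poly"
    Complex_Main
begin

text \<open>
  A finite simple undirected graph is a \<^const>\<open>pair_graph\<close>: an irreflexive symmetric set of
  pairs over a finite vertex set, where an edge \<open>uv\<close> is the pair of arcs \<open>(u, v)\<close>, \<open>(v, u)\<close>.
  The degree of \<open>v\<close> is therefore \<^const>\<open>out_degree\<close>.

  Matrices are indexed by \<open>{0..<n}\<close>, so the vertices have to be listed in some order. A different
  order conjugates the matrices below by a permutation matrix, which leaves the spectrum unchanged.
\<close>

definition vertex_list :: "'a pair_pre_digraph \<Rightarrow> 'a list" where
  "vertex_list G = (SOME vs. distinct vs \<and> set vs = pverts G)"

lemma vertex_list:
  assumes "finite (pverts G)"
  shows "distinct (vertex_list G)" and "set (vertex_list G) = pverts G"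
    and "length (vertex_list G) = card (pverts G)"
proof -
  have "\<exists>vs. distinct vs \<and> set vs = pverts G"
    using finite_distinct_list[OF assms] by blast
  then have *: "distinct (vertex_list G) \<and> set (vertex_list G) = pverts G"
    unfolding vertex_list_def by (rule someI_ex)
  then show "distinct (vertex_list G)" and "set (vertex_list G) = pverts G" by auto
  with distinct_card show "length (vertex_list G) = card (pverts G)" by metis
qed

definition adjacency_mat :: "'a pair_pre_digraph \<Rightarrow> real mat" where
  "adjacency_mat G = (let n = card (pverts G); vs = vertex_list G in
     mat n n (\<lambda>(i, j). if (vs ! i, vs ! j) \<in> parcs G then 1 else 0))"

definition degree_mat :: "'a pair_pre_digraph \<Rightarrow> real mat" where
  "degree_mat G = (let n = card (pverts G); vs = vertex_list G in
     mat n n (\<lambda>(i, j). if i = j then real (out_degree G (vs ! i)) else 0))"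

definition laplacian :: "'a pair_pre_digraph \<Rightarrow> real mat" where
  "laplacian G = degree_mat G - adjacency_mat G"

definition mat_trace :: "real mat \<Rightarrow> real" where
  "mat_trace A = (\<Sum>i<dim_row A. A $$ (i, i))"

definition density_mat :: "'a pair_pre_digraph \<Rightarrow> real mat" where
  "density_mat G = (1 / mat_trace (laplacian G)) \<cdot>\<^sub>m laplacian G"

text \<open>
  The density matrix is real symmetric, so its characteristic polynomial splits over the reals and
  its multiset of real roots contains all \<open>n\<close> eigenvalues with multiplicity.
\<close>

definition density_spectrum :: "'a pair_pre_digraph \<Rightarrow> real multiset" where
  "density_spectrum G = proots (char_poly (density_mat G))"

text \<open>The convention \<open>0 log 0 = 0\<close> holds because multiplication by \<open>0\<close> gives \<open>0\<close>.\<close>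

definition von_neumann_entropy :: "'a pair_pre_digraph \<Rightarrow> real" where
  "von_neumann_entropy G = - (\<Sum>x\<in>#density_spectrum G. x * log 2 x)"

text \<open>
  The order \<open>\<alpha>\<close> is meant to satisfy \<open>\<alpha> \<ge> 0\<close> and \<open>\<alpha> \<noteq> 1\<close>. As \<open>0 powr 0 = 0\<close>, the value at
  \<open>\<alpha> = 0\<close> is the logarithm of the rank.
\<close>

definition renyi_entropy :: "real \<Rightarrow> 'a pair_pre_digraph \<Rightarrow> real" where
  "renyi_entropy \<alpha> G = 1 / (1 - \<alpha>) * log 2 (\<Sum>x\<in>#density_spectrum G. x powr \<alpha>)"

text \<open>The star \<open>K\<^bsub>1,n-1\<^esub>\<close> with centre \<open>0\<close>.\<close>

definition star_graph :: "nat \<Rightarrow> nat pair_pre_digraph" where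
  "star_graph n = \<lparr> pverts = {0..<n}, parcs = {0} \<times> {1..<n} \<union> {1..<n} \<times> {0} \<rparr>"

lemma star_graph_complete_bipartite:
  assumes "n \<ge> 1"
  shows "complete_bipartite_digraph 1 (n - 1) (with_proj (star_graph n))"
  unfolding complete_bipartite_digraph_pair_def
  by (intro conjI exI[of _ "{0}"] exI[of _ "{1..<n}"]) (use assms in \<open>auto simp: star_graph_def\<close>)

end

theory Submission
  imports Defs "Jordan_Normal_Form.Schur_Decomposition"
begin

text \<open>
  The density matrix is symmetric and positive semidefinite with trace one, and the sum of the
  squares of its eigenvalues is the sum of its squared entries, \<open>Q = (\<Sum> d\<^sub>i\<^sup>2 + d\<^sub>G) / d\<^sub>G\<^sup>2\<close>.
  Hence \<open>H\<^sub>2 = - log Q\<close>, and \<open>S \<ge> H\<^sub>2\<close> is Jensen's inequality for the logarithm. The right-hand side of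
  the hypothesis is \<open>2\<close> to the power of the entropy of the star.
\<close>

section \<open>Spectra of real symmetric matrices\<close>

text \<open>The Hermitian form of \<open>A\<close> at an eigenvector equals \<open>e\<close> times
  the squared norm of the eigenvector. It is its own conjugate because \<open>A\<close> is real and
  symmetric, so \<open>e\<close> is a quotient of two reals.\<close>

lemma eigenvalue_real_symmetric:
  fixes A :: "real mat" and e :: complex
  assumes A: "A \<in> carrier_mat n n"
    and sym: "\<And>i j. i < n \<Longrightarrow> j < n \<Longrightarrow> A $$ (i, j) = A $$ (j, i)"
    and ev: "eigenvalue (map_mat complex_of_real A) e"
  shows "e \<in> \<real>"
proof -
  obtain v where v: "v \<in> carrier_vec n" "v \<noteq> 0\<^sub>v n"
    and eq: "map_mat complex_of_real A *\<^sub>v v = e \<cdot>\<^sub>v v"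
    using ev A unfolding eigenvalue_def eigenvector_def by auto
  have row: "(\<Sum>j<n. complex_of_real (A $$ (i, j)) * v $ j) = e * v $ i" if "i < n" for i
  proof -
    have "(map_mat complex_of_real A *\<^sub>v v) $ i = (\<Sum>j<n. complex_of_real (A $$ (i, j)) * v $ j)"
      using that A v by (simp add: scalar_prod_def atLeast0LessThan)
    with that v show ?thesis by (simp add: eq)
  qed
  define q where "q = (\<Sum>i<n. \<Sum>j<n. cnj (v $ i) * complex_of_real (A $$ (i, j)) * v $ j)"
  define s where "s = (\<Sum>i<n. (cmod (v $ i))\<^sup>2)"
  have "q = (\<Sum>i<n. cnj (v $ i) * (e * v $ i))"
    unfolding q_def by (intro sum.cong refl) (simp add: row[symmetric] sum_distrib_left mult.assoc)
  also have "\<dots> = e * complex_of_real s"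
    unfolding s_def of_real_sum sum_distrib_left
    by (intro sum.cong refl) (simp only: complex_norm_square mult_ac)
  finally have q: "q = e * complex_of_real s" .
  have "cnj q = (\<Sum>i<n. \<Sum>j<n. v $ i * complex_of_real (A $$ (i, j)) * cnj (v $ j))"
    by (simp add: q_def)
  also have "\<dots> = (\<Sum>j<n. \<Sum>i<n. v $ i * complex_of_real (A $$ (i, j)) * cnj (v $ j))"
    by (rule sum.swap)
  also have "\<dots> = q"
    unfolding q_def by (intro sum.cong refl) (simp add: sym mult_ac)
  finally have "q \<in> \<real>" by (simp add: Reals_cnj_iff)
  have "s \<noteq> 0"
  proof
    assume "s = 0"
    then have "\<forall>i<n. v $ i = 0"
      unfolding s_def by (subst (asm) sum_nonneg_eq_0_iff) auto
    then have "v = 0\<^sub>v n" using v by (intro eq_vecI) auto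
    with v show False by simp
  qed
  then have "e = q / complex_of_real s" by (simp add: q)
  with \<open>q \<in> \<real>\<close> show ?thesis by simp
qed

text \<open>Over the complex numbers the polynomial splits, and all its roots are real. The
  factorization therefore descends to the reals, since embedding the coefficients is
  injective.\<close>

lemma char_poly_real_symmetric_splits:
  fixes A :: "real mat"
  assumes A: "A \<in> carrier_mat n n"
    and sym: "\<And>i j. i < n \<Longrightarrow> j < n \<Longrightarrow> A $$ (i, j) = A $$ (j, i)"
  obtains es where "char_poly A = (\<Prod>e\<leftarrow>es. [:- e, 1:])"
proof -
  interpret cpoly: map_poly_inj_comm_ring_hom complex_of_real ..
  let ?B = "map_mat complex_of_real A"
  have B: "?B \<in> carrier_mat n n" using A by simp
  obtain as where as: "char_poly ?B = (\<Prod>a\<leftarrow>as. [:- a, 1:])"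
    using char_poly_factorized[OF B] by blast
  have "a \<in> \<real>" if "a \<in> set as" for a
  proof -
    have "poly (char_poly ?B) a = 0"
      unfolding as using that by (induction as) auto
    then show ?thesis
      using eigenvalue_real_symmetric[OF A sym] eigenvalue_root_char_poly[OF B] by blast
  qed
  then have "map_poly complex_of_real (\<Prod>a\<leftarrow>as. [:- Re a, 1:]) = (\<Prod>a\<leftarrow>as. [:- a, 1:])"
    by (induction as) (auto simp: cpoly.hom_mult simp del: mult_pCons_left)
  then have "map_poly complex_of_real (\<Prod>a\<leftarrow>as. [:- Re a, 1:])
      = map_poly complex_of_real (char_poly A)"
    by (simp only: as[symmetric] of_real_hom.char_poly_hom[OF A])
  then have "char_poly A = (\<Prod>e\<leftarrow>map Re as. [:- e, 1:])"
    by (simp add: o_def cpoly.eq_iff)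
  then show ?thesis by (rule that)
qed

section \<open>Traces and the first two power sums of the spectrum\<close>

lemma mat_trace_mult_commute:
  assumes "A \<in> carrier_mat n n" "B \<in> carrier_mat n n"
  shows "mat_trace (A * B) = mat_trace (B * A)"
proof -
  have "mat_trace (A * B) = (\<Sum>i<n. \<Sum>j<n. A $$ (i, j) * B $$ (j, i))"
    using assms by (simp add: mat_trace_def scalar_prod_def atLeast0LessThan)
  also have "\<dots> = (\<Sum>j<n. \<Sum>i<n. A $$ (i, j) * B $$ (j, i))"
    by (rule sum.swap)
  also have "\<dots> = mat_trace (B * A)"
    using assms by (simp add: mat_trace_def scalar_prod_def atLeast0LessThan mult.commute)
  finally show ?thesis .
qed

lemma mat_trace_similar:
  assumes "A \<in> carrier_mat n n" "similar_mat_wit A B P Q"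
  shows "mat_trace A = mat_trace B"
proof -
  note D = similar_mat_witD2[OF assms]
  have "mat_trace A = mat_trace ((P * B) * Q)" using D by simp
  also have "\<dots> = mat_trace (Q * (P * B))"
    by (rule mat_trace_mult_commute[of _ n]) (use D in auto)
  also have "Q * (P * B) = (Q * P) * B" using D by (intro assoc_mult_mat[symmetric]) auto
  also have "\<dots> = B" using D by simp
  finally show ?thesis .
qed

text \<open>A Schur triangular form \<open>B\<close> carries the eigenvalues on its diagonal, and
  squaring it squares that diagonal. So the power sums are the traces of \<open>A\<close> and
  \<open>A * A\<close>; by symmetry the latter is the sum of the squared entries of
  \<open>A\<close>.\<close>

lemma real_symmetric_spectrum_sums:
  fixes A :: "real mat"
  assumes A: "A \<in> carrier_mat n n"
    and sym: "\<And>i j. i < n \<Longrightarrow> j < n \<Longrightarrow> A $$ (i, j) = A $$ (j, i)"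
  shows "(\<Sum>x\<in>#proots (char_poly A). x) = mat_trace A"
    and "(\<Sum>x\<in>#proots (char_poly A). x\<^sup>2) = (\<Sum>i<n. \<Sum>j<n. (A $$ (i, j))\<^sup>2)"
proof -
  obtain es where es: "char_poly A = (\<Prod>e\<leftarrow>es. [:- e, 1:])"
    using char_poly_real_symmetric_splits[OF A sym] by blast
  have spec: "proots (char_poly A) = mset es"
  proof -
    have "proots (\<Prod>e\<leftarrow>es. [:- e, 1:]) = mset es"
    proof (induction es)
      case (Cons e es)
      have "(\<Prod>e\<leftarrow>es. [:- e, 1:]) \<noteq> 0" by (auto simp: prod_list_zero_iff)
      with Cons show ?case by (simp add: proots_mult del: mult_pCons_left)
    qed simp
    then show ?thesis by (simp only: es)
  qed
  obtain B P Q where "schur_decomposition A es = (B, P, Q)" by (metis prod_cases3)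
  then have sim: "similar_mat_wit A B P Q" and ut: "upper_triangular B" and diag: "diag_mat B = es"
    using schur_decomposition[OF A es] by auto
  have B: "B \<in> carrier_mat n n" using similar_mat_witD2[OF A sim] by auto
  have sum_es: "(\<Sum>x\<leftarrow>es. f x) = (\<Sum>i<n. f (B $$ (i, i)))" for f :: "real \<Rightarrow> real"
    using B by (simp add: diag[symmetric] diag_mat_def o_def sum_list_distinct_conv_sum_set
        atLeast0LessThan)
  have "(\<Sum>x\<in>#proots (char_poly A). x) = mat_trace B"
    using B sum_es[of "\<lambda>x. x"] by (simp add: spec mat_trace_def flip: sum_mset_sum_list)
  then show "(\<Sum>x\<in>#proots (char_poly A). x) = mat_trace A"
    by (simp add: mat_trace_similar[OF A sim])
  have sim2: "similar_mat_wit (A * A) (B * B) P Q"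
    using similar_mat_wit_pow[OF sim, of 2] A B by (simp add: numeral_2_eq_2)
  have BB: "(\<Sum>j<n. B $$ (i, j) * B $$ (j, i)) = (B $$ (i, i))\<^sup>2" if "i < n" for i
  proof -
    \<comment> \<open>Of the positions (i, j) and (j, i) with i \<noteq> j, one lies strictly below
      the diagonal.\<close>
    have "B $$ (i, j) * B $$ (j, i) = 0" if "j < n" "j \<noteq> i" for j
      using upper_triangularD[OF ut, of j i] upper_triangularD[OF ut, of i j] that \<open>i < n\<close> B
      by (cases "j < i") auto
    then have "(\<Sum>j<n. B $$ (i, j) * B $$ (j, i)) = (\<Sum>j\<in>{i}. B $$ (i, j) * B $$ (j, i))"
      using that by (intro sum.mono_neutral_right) auto
    then show ?thesis by (simp add: power2_eq_square)
  qed
  have "(\<Sum>x\<in>#proots (char_poly A). x\<^sup>2) = mat_trace (B * B)"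
    using B sum_es[of "\<lambda>x. x\<^sup>2"]
    by (simp add: spec mat_trace_def scalar_prod_def atLeast0LessThan BB flip: sum_mset_sum_list)
  also have "\<dots> = mat_trace (A * A)"
    using mat_trace_similar[OF _ sim2, of n] A by simp
  also have "\<dots> = (\<Sum>i<n. \<Sum>j<n. (A $$ (i, j))\<^sup>2)"
    using A by (simp add: mat_trace_def scalar_prod_def atLeast0LessThan sym power2_eq_square)
  finally show "(\<Sum>x\<in>#proots (char_poly A). x\<^sup>2) = (\<Sum>i<n. \<Sum>j<n. (A $$ (i, j))\<^sup>2)" .
qed


section \<open>The spectrum of the density matrix\<close>

text \<open>The chosen enumeration is a bijection, so sums over matrix indices become sums over
  vertices and the arbitrary order disappears.\<close>

lemma sum_vertex_list:
  assumes "finite (pverts G)"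
  shows "(\<Sum>i<card (pverts G). f (vertex_list G ! i)) = (\<Sum>v\<in>pverts G. f v)"
proof -
  note vl = vertex_list[OF assms]
  have "bij_betw (\<lambda>i. vertex_list G ! i) {..<card (pverts G)} (pverts G)"
    using bij_betw_nth[OF vl(1)] vl by auto
  then show ?thesis by (rule sum.reindex_bij_betw)
qed

section \<open>Entries and moments of the Laplacian and the density matrix\<close>

lemma (in pair_graph) out_degree_eq_card_neighbours:
  "out_degree G v = card {w \<in> pverts G. (v, w) \<in> parcs G}"
proof -
  have "out_arcs G v = Pair v ` {w \<in> pverts G. (v, w) \<in> parcs G}"
    using wellformed by (force simp: out_arcs_def)
  then show ?thesis by (simp add: out_degree_def card_image inj_on_def)
qed

lemma (in pair_graph) laplacian_entry:
  assumes "i < card (pverts G)" "j < card (pverts G)"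
  shows "laplacian G $$ (i, j) =
    (if i = j then real (out_degree G (vertex_list G ! i))
     else if (vertex_list G ! i, vertex_list G ! j) \<in> parcs G then - 1 else 0)"
  using assms by (auto simp: laplacian_def degree_mat_def adjacency_mat_def Let_def dest: no_loops)

lemma laplacian_carrier: "laplacian G \<in> carrier_mat (card (pverts G)) (card (pverts G))"
  by (auto simp: laplacian_def degree_mat_def adjacency_mat_def Let_def)

lemma density_carrier: "density_mat G \<in> carrier_mat (card (pverts G)) (card (pverts G))"
  using laplacian_carrier[of G] by (simp add: density_mat_def)

context pair_graph
begin

lemma mat_trace_laplacian: "mat_trace (laplacian G) = (\<Sum>v\<in>pverts G. real (out_degree G v))"
  using laplacian_carrier[of G] sum_vertex_list[of G "\<lambda>v. real (out_degree G v)"]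
  by (simp add: mat_trace_def laplacian_entry)

lemma sum_out_degree_pos:
  assumes "parcs G \<noteq> {}"
  shows "(\<Sum>v\<in>pverts G. real (out_degree G v)) > 0"
proof -
  obtain u w where uw: "(u, w) \<in> parcs G" using assms by auto
  then have "u \<in> pverts G" "w \<in> pverts G" using wellformed by force+
  with uw have "out_degree G u > 0"
    by (auto simp: out_degree_eq_card_neighbours card_gt_0_iff)
  with \<open>u \<in> pverts G\<close> show ?thesis
    by (intro sum_pos2[of _ u]) auto
qed

text \<open>A row at a vertex of degree d holds one diagonal entry d and d entries -1, which
  contribute d^2 + d.\<close>

lemma sum_laplacian_squares:
  "(\<Sum>i<card (pverts G). \<Sum>j<card (pverts G). (laplacian G $$ (i, j))\<^sup>2)
    = (\<Sum>v\<in>pverts G. (real (out_degree G v))\<^sup>2) + (\<Sum>v\<in>pverts G. real (out_degree G v))"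
proof -
  let ?n = "card (pverts G)" and ?v = "\<lambda>i. vertex_list G ! i"
  have row: "(\<Sum>j<?n. (laplacian G $$ (i, j))\<^sup>2)
      = (real (out_degree G (?v i)))\<^sup>2 + real (out_degree G (?v i))" if i: "i < ?n" for i
  proof -
    \<comment> \<open>Without loops the adjacency indicator vanishes at \<open>j = i\<close>, so the
      two summands never overlap.\<close>
    have "(\<Sum>j<?n. (laplacian G $$ (i, j))\<^sup>2)
      = (\<Sum>j<?n. (if i = j then (real (out_degree G (?v i)))\<^sup>2 else 0)
          + (if (?v i, ?v j) \<in> parcs G then 1 else 0))"
      using i by (intro sum.cong) (auto simp: laplacian_entry dest: no_loops)
    also have "\<dots> = (real (out_degree G (?v i)))\<^sup>2
        + (\<Sum>j<?n. if (?v i, ?v j) \<in> parcs G then 1 else 0)"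
      using i by (simp add: sum.distrib)
    also have "(\<Sum>j<?n. if (?v i, ?v j) \<in> parcs G then 1 else 0)
        = (\<Sum>w\<in>pverts G. if (?v i, w) \<in> parcs G then 1 else (0::real))"
      by (rule sum_vertex_list) simp
    also have "\<dots> = real (out_degree G (?v i))"
      by (simp add: out_degree_eq_card_neighbours sum.If_cases Int_def)
    finally show ?thesis .
  qed
  then show ?thesis
    using sum_vertex_list[of G "\<lambda>v. (real (out_degree G v))\<^sup>2 + real (out_degree G v)"]
    by (simp add: sum.distrib)
qed

lemma density_entry:
  assumes "i < card (pverts G)" "j < card (pverts G)"
  shows "density_mat G $$ (i, j) = laplacian G $$ (i, j) / mat_trace (laplacian G)"
  using assms laplacian_carrier[of G] by (simp add: density_mat_def)

lemma density_symmetric: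
  assumes "i < card (pverts G)" "j < card (pverts G)"
  shows "density_mat G $$ (i, j) = density_mat G $$ (j, i)"
  using assms arcs_symmetric by (auto simp: density_entry laplacian_entry)

lemma sum_density_spectrum:
  assumes "parcs G \<noteq> {}"
  shows "(\<Sum>x\<in>#density_spectrum G. x) = 1"
proof -
  have "mat_trace (density_mat G) = mat_trace (laplacian G) / mat_trace (laplacian G)"
    using laplacian_carrier[of G] density_carrier[of G]
    by (simp add: mat_trace_def density_entry flip: sum_divide_distrib)
  also have "\<dots> = 1" using sum_out_degree_pos[OF assms] by (simp add: mat_trace_laplacian)
  finally show ?thesis
    using real_symmetric_spectrum_sums(1)[OF density_carrier density_symmetric]
    by (simp add: density_spectrum_def)
qed

lemma sum_density_spectrum_squares:
  "(\<Sum>x\<in>#density_spectrum G. x\<^sup>2)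
    = ((\<Sum>v\<in>pverts G. (real (out_degree G v))\<^sup>2) + (\<Sum>v\<in>pverts G. real (out_degree G v)))
      / (\<Sum>v\<in>pverts G. real (out_degree G v))\<^sup>2"
proof -
  have "(\<Sum>x\<in>#density_spectrum G. x\<^sup>2)
      = (\<Sum>i<card (pverts G). \<Sum>j<card (pverts G). (density_mat G $$ (i, j))\<^sup>2)"
    unfolding density_spectrum_def
    by (rule real_symmetric_spectrum_sums(2)[OF density_carrier density_symmetric])
  also have "\<dots> = (\<Sum>i<card (pverts G). \<Sum>j<card (pverts G). (laplacian G $$ (i, j))\<^sup>2)
      / (mat_trace (laplacian G))\<^sup>2"
    by (simp add: density_entry power_divide sum_divide_distrib)
  finally show ?thesis by (simp only: sum_laplacian_squares mat_trace_laplacian)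
qed

text \<open>An eigenvector is read as a function on the vertices, and the trace is multiplied out.
  The result is the eigenvalue equation of the graph Laplacian, free of the vertex order; it serves
  both for nonnegativity and for the spectrum of the star.\<close>

lemma density_spectrum_eigenfunction:
  assumes "parcs G \<noteq> {}" and "x \<in># density_spectrum G"
  obtains f where "\<exists>v\<in>pverts G. f v \<noteq> 0"
    and "\<And>v. v \<in> pverts G \<Longrightarrow> (\<Sum>w | w \<in> pverts G \<and> (v, w) \<in> parcs G. f v - f w)
           = (\<Sum>v\<in>pverts G. real (out_degree G v)) * x * f v"
proof -
  let ?n = "card (pverts G)" and ?v = "\<lambda>i. vertex_list G ! i"
  let ?t = "\<Sum>v\<in>pverts G. real (out_degree G v)"
  note vl = vertex_list[OF finite_verts, simplified]
  have "char_poly (density_mat G) \<noteq> 0"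
    using degree_monic_char_poly[OF density_carrier[of G]] by auto
  then have "poly (char_poly (density_mat G)) x = 0"
    using assms(2) by (simp add: density_spectrum_def)
  then have "eigenvalue (density_mat G) x"
    using eigenvalue_root_char_poly[OF density_carrier] by blast
  then obtain u where u: "u \<in> carrier_vec ?n" "u \<noteq> 0\<^sub>v ?n"
    and eq: "density_mat G *\<^sub>v u = x \<cdot>\<^sub>v u"
    using density_carrier[of G] unfolding eigenvalue_def eigenvector_def by auto
  have bij: "bij_betw ?v {..<?n} (pverts G)"
    using bij_betw_nth[OF vl(1)] vl by auto
  \<comment> \<open>The vector is transported along the inverse of the enumeration; values outside
    \<open>pverts G\<close> do not matter.\<close>
  define f where "f v = u $ the_inv_into {..<?n} ?v v" for v
  have f: "f (?v i) = u $ i" if "i < ?n" for i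
    using that bij by (simp add: f_def the_inv_into_f_f bij_betw_def)
  have "\<exists>i<?n. u $ i \<noteq> 0"
    using u by (metis carrier_vecD eq_vecI index_zero_vec)
  then have "\<exists>v\<in>pverts G. f v \<noteq> 0"
    using bij f by (metis bij_betwE lessThan_iff)
  moreover have "(\<Sum>w | w \<in> pverts G \<and> (v, w) \<in> parcs G. f v - f w) = ?t * x * f v"
    if v: "v \<in> pverts G" for v
  proof -
    obtain i where i: "i < ?n" "?v i = v"
      using v by (metis bij bij_betw_imp_surj_on imageE lessThan_iff)
    have "x * f v = (density_mat G *\<^sub>v u) $ i"
      using i f[of i] u by (simp add: eq)
    also have "\<dots> = (\<Sum>j<?n. density_mat G $$ (i, j) * u $ j)"
      using i u density_carrier[of G] by (simp add: scalar_prod_def atLeast0LessThan)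
    also have "\<dots> = (\<Sum>j<?n. laplacian G $$ (i, j) * u $ j) / ?t"
      using i by (simp add: density_entry mat_trace_laplacian sum_divide_distrib)
    finally have "?t * x * f v = (\<Sum>j<?n. laplacian G $$ (i, j) * u $ j)"
      using sum_out_degree_pos[OF assms(1)] by (simp add: field_simps)
    also have "\<dots> = (\<Sum>j<?n. (if i = j then real (out_degree G v) * f v else 0)
          - (if (v, ?v j) \<in> parcs G then f (?v j) else 0))"
      using i by (intro sum.cong) (auto simp: laplacian_entry f dest: no_loops)
    also have "\<dots> = real (out_degree G v) * f v
        - (\<Sum>j<?n. if (v, ?v j) \<in> parcs G then f (?v j) else 0)"
      using i by (simp add: sum_subtractf)
    also have "(\<Sum>j<?n. if (v, ?v j) \<in> parcs G then f (?v j) else 0)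
        = (\<Sum>w\<in>pverts G. if (v, w) \<in> parcs G then f w else 0)"
      by (rule sum_vertex_list) simp
    also have "\<dots> = (\<Sum>w | w \<in> pverts G \<and> (v, w) \<in> parcs G. f w)"
      by (simp add: sum.If_cases Int_def)
    finally show ?thesis
      by (simp add: sum_subtractf out_degree_eq_card_neighbours)
  qed
  ultimately show ?thesis by (rule that)
qed

text \<open>Evaluate the eigenvalue equation at a vertex where the eigenfunction is largest in modulus.\<close>

lemma density_spectrum_nonneg:
  assumes "parcs G \<noteq> {}" and "x \<in># density_spectrum G"
  shows "x \<ge> 0"
proof -
  let ?t = "\<Sum>v\<in>pverts G. real (out_degree G v)"
  obtain f where f0: "\<exists>v\<in>pverts G. f v \<noteq> 0"
    and f: "\<And>v. v \<in> pverts G \<Longrightarrow>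
      (\<Sum>w | w \<in> pverts G \<and> (v, w) \<in> parcs G. f v - f w) = ?t * x * f v"
    using density_spectrum_eigenfunction[OF assms] by blast
  define m where "m = Max ((\<lambda>v. \<bar>f v\<bar>) ` pverts G)"
  have fin: "finite ((\<lambda>v. \<bar>f v\<bar>) ` pverts G)" by simp
  have "m \<in> (\<lambda>v. \<bar>f v\<bar>) ` pverts G" unfolding m_def using f0 by (intro Max_in) auto
  then obtain v where v: "v \<in> pverts G" "m = \<bar>f v\<bar>" by blast
  have max: "\<bar>f w\<bar> \<le> \<bar>f v\<bar>" if "w \<in> pverts G" for w
    unfolding v(2)[symmetric] m_def using fin that by (intro Max_ge) auto
  have "f v \<noteq> 0" using f0 max by fastforce
  \<comment> \<open>Multiplying by \<open>f v\<close> covers both signs at once: maximality of the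
    modulus gives f v * f w \<le> f v * f v for each neighbour \<open>w\<close>.\<close>
  have "0 \<le> (\<Sum>w | w \<in> pverts G \<and> (v, w) \<in> parcs G. f v * (f v - f w))"
  proof (intro sum_nonneg)
    fix w assume "w \<in> {w. w \<in> pverts G \<and> (v, w) \<in> parcs G}"
    then have "\<bar>f v * f w\<bar> \<le> \<bar>f v * f v\<bar>"
      using max[of w] unfolding abs_mult by (intro mult_left_mono) auto
    then show "0 \<le> f v * (f v - f w)" by (simp add: algebra_simps)
  qed
  also have "\<dots> = ?t * x * (f v)\<^sup>2"
    by (simp add: sum_distrib_left[symmetric] f[OF v(1)] power2_eq_square)
  finally have "0 \<le> (?t * (f v)\<^sup>2) * x" by (simp only: mult_ac)
  moreover have "?t * (f v)\<^sup>2 > 0"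
    using \<open>f v \<noteq> 0\<close> sum_out_degree_pos[OF assms(1)] by (intro mult_pos_pos) auto
  ultimately show ?thesis by (simp only: zero_le_mult_iff) linarith
qed

text \<open>Nonnegativity of the spectrum lets \<open>powr\<close> with exponent 2 be read as an
  ordinary square.\<close>

lemma renyi_entropy_2_eq:
  assumes "parcs G \<noteq> {}"
  shows "renyi_entropy 2 G = - log 2 (\<Sum>x\<in>#density_spectrum G. x\<^sup>2)"
proof -
  have "(\<Sum>x\<in>#density_spectrum G. x powr 2) = (\<Sum>x\<in>#density_spectrum G. x\<^sup>2)"
    using density_spectrum_nonneg[OF assms]
    by (intro arg_cong[of _ _ sum_mset] image_mset_cong) simp
  then show ?thesis by (simp add: renyi_entropy_def)
qed

end


section \<open>Entropies\<close>

text \<open>Jensen's inequality with the elements of \<open>M\<close> as both weights and points: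
  their weighted mean is the sum of squares \<open>Q\<close>. Bounding the logarithm by its tangent
  at \<open>Q\<close> and averaging gives exactly \<open>ln Q\<close>.\<close>

lemma shannon_entropy_ge_collision_entropy:
  fixes M :: "real multiset"
  assumes nonneg: "\<And>x. x \<in># M \<Longrightarrow> x \<ge> 0" and sum1: "(\<Sum>x\<in>#M. x) = 1"
    and pos: "(\<Sum>x\<in>#M. x\<^sup>2) > 0"
  shows "- log 2 (\<Sum>x\<in>#M. x\<^sup>2) \<le> - (\<Sum>x\<in>#M. x * log 2 x)"
proof -
  define Q where "Q = (\<Sum>x\<in>#M. x\<^sup>2)"
  have Q: "Q > 0" using pos by (simp add: Q_def)
  \<comment> \<open>tangent line of the logarithm at \<open>Q\<close>\<close>
  have "x * ln x \<le> x * (ln Q - 1) + x\<^sup>2 * (1 / Q)" if "x \<in># M" for x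
  proof (cases "x = 0")
    case False
    then have x: "x > 0" using nonneg[OF that] by simp
    then have "ln (x / Q) \<le> x / Q - 1" using Q by (intro ln_le_minus_one) simp
    then have "ln x \<le> ln Q - 1 + x / Q" using x Q by (simp add: ln_div)
    then have "x * ln x \<le> x * (ln Q - 1 + x / Q)" using x by (intro mult_left_mono) auto
    then show ?thesis by (simp add: algebra_simps power2_eq_square)
  qed simp
  then have "(\<Sum>x\<in>#M. x * ln x) \<le> (\<Sum>x\<in>#M. x * (ln Q - 1) + x\<^sup>2 * (1 / Q))"
    by (rule sum_mset_mono)
  also have "\<dots> = (\<Sum>x\<in>#M. x) * (ln Q - 1) + (\<Sum>x\<in>#M. x\<^sup>2) * (1 / Q)"
    by (simp only: sum_mset.distrib sum_mset_distrib_right)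
  \<comment> \<open>The weights sum to 1 and the squares to \<open>Q\<close>, so the terms -1 and
    \<open>Q * (1 / Q)\<close> cancel.\<close>
  also have "\<dots> = ln Q" using Q sum1 by (simp flip: Q_def)
  finally have "(\<Sum>x\<in>#M. x * ln x) / ln 2 \<le> ln Q / ln 2" by (simp add: divide_right_mono)
  moreover have "(\<Sum>x\<in>#M. x * log 2 x) = (\<Sum>x\<in>#M. x * ln x) / ln 2"
    using sum_mset_distrib_right[of "\<lambda>x. x * ln x" M "1 / ln 2"] by (simp add: log_def)
  ultimately show ?thesis by (simp add: log_def flip: Q_def)
qed

section \<open>Degrees, spectrum and entropy of the star\<close>

lemma pair_graph_star_graph: "pair_graph (star_graph n)"
  by unfold_locales (auto simp: star_graph_def symmetric_def intro!: symI)

lemma out_degree_star_graph: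
  assumes "v < n"
  shows "out_degree (star_graph n) v = (if v = 0 then n - 1 else 1)"
proof -
  interpret S: pair_graph "star_graph n" by (rule pair_graph_star_graph)
  have "{w \<in> pverts (star_graph n). (v, w) \<in> parcs (star_graph n)} = (if v = 0 then {1..<n} else {0})"
    using assms by (auto simp: star_graph_def)
  then show ?thesis by (simp add: S.out_degree_eq_card_neighbours)
qed

lemma star_graph_degree_sums:
  assumes "n \<ge> 2"
  shows "(\<Sum>v\<in>pverts (star_graph n). real (out_degree (star_graph n) v)) = 2 * real n - 2"
    and "(\<Sum>v\<in>pverts (star_graph n). (real (out_degree (star_graph n) v))\<^sup>2)
          = (real n - 1)\<^sup>2 + (real n - 1)"
proof -
  have V: "pverts (star_graph n) = insert 0 {1..<n}"
    using assms by (auto simp: star_graph_def)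
  \<comment> \<open>An arbitrary function \<open>g\<close> of the degree makes both sums instances:
    one centre of degree \<open>n - 1\<close> and n - 1 leaves of degree 1.\<close>
  have *: "(\<Sum>v\<in>pverts (star_graph n). g (out_degree (star_graph n) v))
      = g (n - 1) + (real n - 1) * g 1" for g :: "nat \<Rightarrow> real"
  proof -
    have "(\<Sum>v\<in>{1..<n}. g (out_degree (star_graph n) v)) = (\<Sum>v\<in>{1..<n}. g 1)"
      by (intro sum.cong) (auto simp: out_degree_star_graph)
    then show ?thesis using assms by (simp add: V out_degree_star_graph of_nat_diff)
  qed
  show "(\<Sum>v\<in>pverts (star_graph n). real (out_degree (star_graph n) v)) = 2 * real n - 2"
    using *[of real] assms by (simp add: of_nat_diff)
  show "(\<Sum>v\<in>pverts (star_graph n). (real (out_degree (star_graph n) v))\<^sup>2)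
      = (real n - 1)\<^sup>2 + (real n - 1)"
    using *[of "\<lambda>d. (real d)\<^sup>2"] assms by (simp add: of_nat_diff)
qed

text \<open>The Laplacian eigenvalues of the star lie in {0, 1, n}. For an eigenvalue other than 1
  the leaf equations determine the eigenfunction from its value at the centre, and the centre
  equation then leaves only 0 and n.\<close>

lemma star_graph_spectrum_subset:
  assumes n: "n \<ge> 2" and x: "x \<in># density_spectrum (star_graph n)"
  shows "x \<in> {0, 1 / (2 * real n - 2), real n / (2 * real n - 2)}"
proof -
  interpret S: pair_graph "star_graph n" by (rule pair_graph_star_graph)
  let ?V = "pverts (star_graph n)" and ?E = "parcs (star_graph n)"
  have "(0, 1) \<in> ?E" using n by (simp add: star_graph_def)
  then have ne: "?E \<noteq> {}" by auto
  obtain f where f0: "\<exists>v\<in>?V. f v \<noteq> 0"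
    and f: "\<And>v. v \<in> ?V \<Longrightarrow>
      (\<Sum>w | w \<in> ?V \<and> (v, w) \<in> ?E. f v - f w) = (2 * real n - 2) * x * f v"
    using S.density_spectrum_eigenfunction[OF ne x] unfolding star_graph_degree_sums(1)[OF n] by blast
  define e where "e = (2 * real n - 2) * x"
  have nbr: "{w. w \<in> ?V \<and> (v, w) \<in> ?E} = (if v = 0 then {1..<n} else {0})" if "v < n" for v
    using that by (auto simp: star_graph_def)
  have V: "v \<in> ?V \<longleftrightarrow> v < n" for v by (simp add: star_graph_def)
  have leaf: "f v * (1 - e) = f 0" if "0 < v" "v < n" for v
    using f[of v] nbr[of v] that by (simp add: V e_def algebra_simps)
  have centre: "(\<Sum>w\<in>{1..<n}. f 0 - f w) = e * f 0"
    using f[of 0] nbr[of 0] n by (simp add: V e_def)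
  have "e \<in> {0, 1, real n}"
  proof (cases "e = 1")
    case False
    \<comment> \<open>If \<open>f 0\<close> were zero, the leaf equation with \<open>e\<close>
      different from 1 would make \<open>f\<close> vanish on every leaf as well.\<close>
    have "f 0 \<noteq> 0"
      using f0 leaf False by (metis V mult_eq_0_iff not_gr_zero right_minus_eq)
    \<comment> \<open>Multiplying the centre equation by \<open>1 - e\<close> eliminates the leaf
      values: each summand becomes \<open>f 0 * (1 - e) - f 0\<close>, that is
      \<open>- e * f 0\<close>.\<close>
    have "e * f 0 * (1 - e) = (\<Sum>w\<in>{1..<n}. (f 0 - f w) * (1 - e))"
      by (simp only: centre flip: sum_distrib_right)
    also have "\<dots> = (\<Sum>w\<in>{1..<n}. - e * f 0)"
      by (intro sum.cong) (auto simp: left_diff_distrib leaf, simp add: algebra_simps)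
    also have "\<dots> = - (real n - 1) * e * f 0" using n by (simp add: of_nat_diff algebra_simps)
    finally have "f 0 * (e * (real n - e)) = 0" by (simp add: algebra_simps)
    with \<open>f 0 \<noteq> 0\<close> show ?thesis by auto
  qed simp
  moreover have "x = e / (2 * real n - 2)" using n by (simp add: e_def)
  ultimately show ?thesis by auto
qed

text \<open>
  On the three possible eigenvalues, \<open>x log x\<close> agrees with the interpolating quadratic
  \<open>\<alpha> x + \<beta> x\<^sup>2\<close>, so the entropy follows from the first two moments and the multiplicities are not
  needed.
\<close>

lemma von_neumann_entropy_star_graph:
  assumes n: "n \<ge> 2"
  shows "von_neumann_entropy (star_graph n)
    = log 2 ((2 * real n - 2) / real n powr (real n / (2 * real n - 2)))"
proof -
  interpret S: pair_graph "star_graph n" by (rule pair_graph_star_graph)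
  have "(0, 1) \<in> parcs (star_graph n)" using n by (simp add: star_graph_def)
  then have ne: "parcs (star_graph n) \<noteq> {}" by auto
  define N where "N = 2 * real n - 2"
  have N: "N > 0" and nN: "real n = N / 2 + 1" using n by (auto simp: N_def field_simps)
  let ?M = "density_spectrum (star_graph n)"
  \<comment> \<open>The line \<alpha> + \<beta> x must match log x at 1/N and n/N. These points
    differ by (n - 1)/N = 1/2 and their logarithms by log n, which gives \<beta>; the value -log N
    at 1/N gives \<alpha>.\<close>
  define \<beta> where "\<beta> = 2 * log 2 (real n)"
  have log_n: "log 2 (real n) = \<beta> / 2" by (simp add: \<beta>_def)
  define \<alpha> where "\<alpha> = - log 2 N - \<beta> / N"
  have "x * log 2 x = x * \<alpha> + x\<^sup>2 * \<beta>" if "x \<in># ?M" for x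
  proof -
    have x3: "x \<in> {0, 1 / N, real n / N}"
      unfolding N_def using n that by (rule star_graph_spectrum_subset)
    consider "x = 0" | "x = 1 / N" | "x = real n / N"
      using x3 by auto
    then show ?thesis
    proof cases
      case 2
      have "log 2 x = \<alpha> + x * \<beta>" using 2 N by (simp add: \<alpha>_def log_divide)
      then show ?thesis by (simp add: algebra_simps power2_eq_square)
    next
      case 3
      have "log 2 x = log 2 (real n) - log 2 N" using 3 N n by (simp add: log_divide)
      also have "\<dots> = \<alpha> + x * \<beta>"
        using N unfolding \<alpha>_def 3 log_n unfolding nN by (simp add: field_simps)
      finally show ?thesis by (simp add: algebra_simps power2_eq_square)
    qed simp
  qed
  then have "(\<Sum>x\<in>#?M. x * log 2 x) = (\<Sum>x\<in>#?M. x * \<alpha> + x\<^sup>2 * \<beta>)"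
    by (intro arg_cong[of _ _ sum_mset] image_mset_cong)
  also have "\<dots> = (\<Sum>x\<in>#?M. x) * \<alpha> + (\<Sum>x\<in>#?M. x\<^sup>2) * \<beta>"
    by (simp only: sum_mset.distrib sum_mset_distrib_right)
  also have "\<dots> = \<alpha> + (((real n - 1)\<^sup>2 + (real n - 1)) + N) / N\<^sup>2 * \<beta>"
    unfolding S.sum_density_spectrum[OF ne] S.sum_density_spectrum_squares
      star_graph_degree_sums[OF n] N_def by simp
  \<comment> \<open>The second moment simplifies to (n + 2)/(2N). Its part 1/N cancels the term
    -\<beta>/N in \<alpha>, and n/(2N) times \<beta> is the remaining logarithm.\<close>
  also have "\<dots> = real n / N * log 2 (real n) - log 2 N"
    using N unfolding \<alpha>_def log_n unfolding nN by (simp add: field_simps power2_eq_square)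
  finally show ?thesis
    using n N by (simp add: von_neumann_entropy_def log_divide log_powr flip: N_def)
qed

theorem theorem2p2:
  fixes G :: "'a pair_pre_digraph" and n :: nat and d\<^sub>G :: real
  assumes "n \<ge> 2"
    and "pair_graph G"
    and "card (pverts G) = n"
    and "parcs G \<noteq> {}"
    and "d\<^sub>G = (\<Sum>v\<in>pverts G. real (out_degree G v))"
    and "d\<^sub>G\<^sup>2 / ((\<Sum>v\<in>pverts G. (real (out_degree G v))\<^sup>2) + d\<^sub>G)
          \<ge> (2 * real n - 2) / real n powr (real n / (2 * real n - 2))"
  shows "von_neumann_entropy G \<ge> renyi_entropy 2 G
       \<and> renyi_entropy 2 G \<ge> von_neumann_entropy (star_graph n)"
proof -
  interpret pair_graph G by fact
  note ne = \<open>parcs G \<noteq> {}\<close>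
  let ?s = "(\<Sum>v\<in>pverts G. (real (out_degree G v))\<^sup>2) + d\<^sub>G"
  let ?Q = "\<Sum>x\<in>#density_spectrum G. x\<^sup>2"
  let ?r = "(2 * real n - 2) / real n powr (real n / (2 * real n - 2))"
  have d: "d\<^sub>G > 0" using sum_out_degree_pos[OF ne] assms(5) by simp
  then have s: "?s > 0" by (intro add_nonneg_pos sum_nonneg) auto
  have Q: "?Q = ?s / d\<^sub>G\<^sup>2" by (simp add: sum_density_spectrum_squares assms(5))
  then have Qpos: "?Q > 0" using d s by simp
  have "renyi_entropy 2 G \<le> von_neumann_entropy G"
    unfolding renyi_entropy_2_eq[OF ne] von_neumann_entropy_def
    by (rule shannon_entropy_ge_collision_entropy)
      (use density_spectrum_nonneg[OF ne] sum_density_spectrum[OF ne] Qpos in auto)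
  moreover have "von_neumann_entropy (star_graph n) \<le> renyi_entropy 2 G"
  proof -
    have "?r > 0" using assms(1) by simp
    then have "log 2 ?r \<le> log 2 (d\<^sub>G\<^sup>2 / ?s)" using assms(6) by (subst log_le_cancel_iff) auto
    also have "\<dots> = - log 2 ?Q" using d s by (simp add: Q log_divide)
    finally show ?thesis
      by (simp only: von_neumann_entropy_star_graph[OF assms(1)] renyi_entropy_2_eq[OF ne])
  qed
  ultimately show ?thesis by simp
qed

end
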